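(* Let $n\ge 1$ and let $\Gamma=\langle R_{-1},R_0,\dots,R_n\rangle$ be a generalized string C-group, and let $\mathcal{K}=\mathcal{K}(\Gamma)$ be the associated partially ordered set. Then $\mathcal{K}$ is a regular incidence complex of rank $n$ on which $\Gamma$ acts (by $\Gamma_i\varphi\mapsto\Gamma_i\varphi\gamma$ for $\gamma\in\Gamma$) as a group of automorphisms, transitively on the flags of $\mathcal{K}$. In particular, $\mathcal{K}$ is finite if $\Gamma$ is finite.
   Context: Let $N=\{-1,0,\dots,n\}$. A generalized C-group is a group $\Gamma$ together with subgroups $R_{-1},R_0,\dots,R_n$ generating $\Gamma$, such that $R_n=R_{-1}$ and $R_{-1}$ is a proper subgroup of $R_i$ for each $i=0,\dots,n-1$, and such that, writing $\Gamma_I=\langle R_i: i\in I\rangle$ for nonempty $I\subseteq N$ and $\Gamma_\emptyset=R_{-1}$, the intersection property $\Gamma_I\cap\Gamma_J=\Gamma_{I\cap J}$ holds for all $I,J\subseteq N$. It is a generalized string C-group if moreover $R_iR_j=R_jR_i$ for all $-1\le i<j-1\le n-1$. Write $\Gamma_i=\Gamma_{N\setminus\{i\}}$, $\Gamma_i^-=\Gamma_{\{-1,\dots,i\}}$, $\Gamma_i^+=\Gamma_{\{i,\dots,n\}}$ (so $\Gamma_{-1}=\Gamma_n=\Gamma$). The poset $\mathcal{K}(\Gamma)$: for $i\in\{0,\dots,n-1\}$ its $i$-faces are the right cosets $\Gamma_i\varphi$ ($\varphi\in\Gamma$); in addition it has two distinct improper faces, both copies of $\Gamma$, denoted $\Gamma_{-1}$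 (rank $-1$) and $\Gamma_n$ (rank $n$), with $\Gamma_{-1}\varphi=\Gamma_{-1}$, $\Gamma_n\varphi=\Gamma_n$. The order is: $\Gamma_i\varphi\le\Gamma_j\psi$ iff $-1\le i\le j\le n$ and $\varphi\psi^{-1}\in\Gamma_{i+1}^+\Gamma_{j-1}^-$. An incidence complex of rank $n$ is a poset satisfying: (I1) a least and a greatest face exist; (I2) every chain lies in a maximal chain (flag) with exactly $n+2$ elements; (I3) every section $G/F=\{H:F\le H\le G\}$ (including the whole poset) is connected, where rank $\le1$ posets are connected and a poset of rank $\ge2$ is connected if any two proper faces are joined by a finite sequence of proper faces with consecutive members comparable; (I4) for $i=0,\dots,n-1$, whenever $F<G$ with ranks $i-1,i+1$ there are at least two $i$-faces strictly between them. It is regular if its automorphism group (order-preserving bijections with order-preserving inverse) is transitive on flags. *)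

theory Defs
  imports "HOL-Algebra.Algebra"
begin

section \<open>Incidence complexes\<close>

text \<open>A poset is given by its set \<open>P\<close> of faces and its reflexive order relation
  \<open>r \<subseteq> P \<times> P\<close>.\<close>

definition is_least :: "'f set \<Rightarrow> 'f rel \<Rightarrow> 'f \<Rightarrow> bool" where
  "is_least P r x \<longleftrightarrow> x \<in> P \<and> (\<forall>y\<in>P. (x, y) \<in> r)"

definition is_greatest :: "'f set \<Rightarrow> 'f rel \<Rightarrow> 'f \<Rightarrow> bool" where
  "is_greatest P r x \<longleftrightarrow> x \<in> P \<and> (\<forall>y\<in>P. (y, x) \<in> r)"

definition proper_faces :: "'f set \<Rightarrow> 'f rel \<Rightarrow> 'f set" where
  "proper_faces P r = {x \<in> P. \<not> is_least P r x \<and> \<not> is_greatest P r x}"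

definition flags :: "'f rel \<Rightarrow> 'f set set" where
  "flags r = {C \<in> Chains r. \<forall>D \<in> Chains r. C \<subseteq> D \<longrightarrow> D = C}"

text \<open>Flags contain the improper faces, so rank \<open>k\<close> means \<open>k + 2\<close> elements in each flag;
  in particular a one-element poset has rank \<open>-1\<close>.\<close>

definition has_rank :: "'f rel \<Rightarrow> int \<Rightarrow> bool" where
  "has_rank r k \<longleftrightarrow> (\<forall>C \<in> flags r. finite C \<and> int (card C) = k + 2)"

definition section_of :: "'f set \<Rightarrow> 'f rel \<Rightarrow> 'f \<Rightarrow> 'f \<Rightarrow> 'f set" where
  "section_of P r F G = {H \<in> P. (F, H) \<in> r \<and> (H, G) \<in> r}"

text \<open>The rank of a face \<open>F\<close> is the rank of the section between the least face and \<open>F\<close>.\<close>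

definition face_has_rank :: "'f set \<Rightarrow> 'f rel \<Rightarrow> 'f \<Rightarrow> int \<Rightarrow> bool" where
  "face_has_rank P r F k \<longleftrightarrow>
     (\<exists>F0. is_least P r F0 \<and> has_rank (Restr r (section_of P r F0 F)) k)"

definition connected_poset :: "'f set \<Rightarrow> 'f rel \<Rightarrow> bool" where
  "connected_poset P r \<longleftrightarrow>
     (\<exists>k. has_rank r k \<and>
        (k \<le> 1 \<or>
         (\<forall>x \<in> proper_faces P r. \<forall>y \<in> proper_faces P r.
            (x, y) \<in> (Restr (r \<union> r\<inverse>) (proper_faces P r))\<^sup>*)))"

definition incidence_complex :: "nat \<Rightarrow> 'f set \<Rightarrow> 'f rel \<Rightarrow> bool" where
  "incidence_complex n P r \<longleftrightarrow>
     partial_order_on P r \<and>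
     (\<exists>F. is_least P r F) \<and> (\<exists>F. is_greatest P r F) \<and>
     (\<forall>C \<in> Chains r. \<exists>D \<in> flags r. C \<subseteq> D \<and> finite D \<and> card D = n + 2) \<and>
     (\<forall>F \<in> P. \<forall>G \<in> P. (F, G) \<in> r \<longrightarrow>
        connected_poset (section_of P r F G) (Restr r (section_of P r F G))) \<and>
     (\<forall>i \<in> {0..int n - 1}. \<forall>F \<in> P. \<forall>G \<in> P.
        (F, G) \<in> r \<and> F \<noteq> G \<and> face_has_rank P r F (i - 1) \<and> face_has_rank P r G (i + 1) \<longrightarrow>
        (\<exists>H1 H2. H1 \<noteq> H2 \<and>
           (\<forall>H \<in> {H1, H2}. H \<in> P \<and> face_has_rank P r H i \<and>
              (F, H) \<in> r \<and> F \<noteq> H \<and> (H, G) \<in> r \<and> H \<noteq> G)))"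

definition poset_automorphism :: "'f set \<Rightarrow> 'f rel \<Rightarrow> ('f \<Rightarrow> 'f) \<Rightarrow> bool" where
  "poset_automorphism P r f \<longleftrightarrow>
     bij_betw f P P \<and> (\<forall>x \<in> P. \<forall>y \<in> P. (x, y) \<in> r \<longleftrightarrow> (f x, f y) \<in> r)"

definition regular_incidence_complex :: "nat \<Rightarrow> 'f set \<Rightarrow> 'f rel \<Rightarrow> bool" where
  "regular_incidence_complex n P r \<longleftrightarrow>
     incidence_complex n P r \<and>
     (\<forall>C \<in> flags r. \<forall>D \<in> flags r. \<exists>f. poset_automorphism P r f \<and> f ` C = D)"

section \<open>Generalized string C-groups\<close>

definition Gam :: "('a, 'b) monoid_scheme \<Rightarrow> (int \<Rightarrow> 'a set) \<Rightarrow> int set \<Rightarrow> 'a set" where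
  "Gam G R I = (if I = {} then R (-1) else generate G (\<Union>i\<in>I. R i))"

locale generalized_C_group = group G for G (structure) +
  fixes n :: nat and R :: "int \<Rightarrow> 'a set"
  assumes subgroup_R: "i \<in> {-1..int n} \<Longrightarrow> subgroup (R i) G"
    and generating: "generate G (\<Union>i\<in>{-1..int n}. R i) = carrier G"
    and R_last: "R (int n) = R (-1)"
    and R_proper: "i \<in> {0..int n - 1} \<Longrightarrow> R (-1) \<subset> R i"
    and intersection_property:
      "\<lbrakk>I \<subseteq> {-1..int n}; J \<subseteq> {-1..int n}\<rbrakk> \<Longrightarrow> Gam G R I \<inter> Gam G R J = Gam G R (I \<inter> J)"

locale generalized_string_C_group = generalized_C_group +
  assumes string_property:
    "\<lbrakk>-1 \<le> i; i < j - 1; j - 1 \<le> int n - 1\<rbrakk> \<Longrightarrow> R i <#> R j = R j <#> R i"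

definition Gam_del :: "('a, 'b) monoid_scheme \<Rightarrow> nat \<Rightarrow> (int \<Rightarrow> 'a set) \<Rightarrow> int \<Rightarrow> 'a set" where
  "Gam_del G n R i = Gam G R ({-1..int n} - {i})"

definition Gam_minus :: "('a, 'b) monoid_scheme \<Rightarrow> (int \<Rightarrow> 'a set) \<Rightarrow> int \<Rightarrow> 'a set" where
  "Gam_minus G R i = Gam G R {-1..i}"

definition Gam_plus :: "('a, 'b) monoid_scheme \<Rightarrow> nat \<Rightarrow> (int \<Rightarrow> 'a set) \<Rightarrow> int \<Rightarrow> 'a set" where
  "Gam_plus G n R i = Gam G R {i..int n}"

section \<open>The poset of a generalized string C-group\<close>

text \<open>Faces are cosets tagged with their rank. The tag keeps the two improper faces apart: since
  \<open>R (int n) = R (-1)\<close>, both \<open>Gam_del G n R (-1)\<close> and \<open>Gam_del G n R (int n)\<close> are the whole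
  group, so each of the ranks \<open>-1\<close> and \<open>n\<close> carries exactly one face.\<close>

definition K_face ::
  "('a, 'b) monoid_scheme \<Rightarrow> nat \<Rightarrow> (int \<Rightarrow> 'a set) \<Rightarrow> int \<Rightarrow> 'a \<Rightarrow> int \<times> 'a set" where
  "K_face G n R i \<phi> = (i, Gam_del G n R i #>\<^bsub>G\<^esub> \<phi>)"

definition K_faces :: "('a, 'b) monoid_scheme \<Rightarrow> nat \<Rightarrow> (int \<Rightarrow> 'a set) \<Rightarrow> (int \<times> 'a set) set" where
  "K_faces G n R = {K_face G n R i \<phi> | i \<phi>. i \<in> {-1..int n} \<and> \<phi> \<in> carrier G}"

text \<open>In a generalized string C-group the condition on \<open>\<phi>\<close> and \<open>\<psi>\<close> does not depend on the choice
  of coset representatives.\<close>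

definition K_order :: "('a, 'b) monoid_scheme \<Rightarrow> nat \<Rightarrow> (int \<Rightarrow> 'a set) \<Rightarrow> (int \<times> 'a set) rel" where
  "K_order G n R =
     {(K_face G n R i \<phi>, K_face G n R j \<psi>) | i \<phi> j \<psi>.
        -1 \<le> i \<and> i \<le> j \<and> j \<le> int n \<and> \<phi> \<in> carrier G \<and> \<psi> \<in> carrier G \<and>
        \<phi> \<otimes>\<^bsub>G\<^esub> inv\<^bsub>G\<^esub> \<psi> \<in> Gam_plus G n R (i + 1) <#>\<^bsub>G\<^esub> Gam_minus G R (j - 1)}"

definition K_act :: "('a, 'b) monoid_scheme \<Rightarrow> 'a \<Rightarrow> int \<times> 'a set \<Rightarrow> int \<times> 'a set" where
  "K_act G \<gamma> F = (fst F, snd F #>\<^bsub>G\<^esub> \<gamma>)"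

end

theory Submission
  imports Defs
begin

text \<open>The string property makes subgroups generated over index sets at distance at least two
  permute, so \<open>\<Gamma>\<^sub>j = \<Gamma>\<^sub>j\<^sub>+\<^sub>1\<^sup>+ \<Gamma>\<^sub>j\<^sub>-\<^sub>1\<^sup>-\<close>. Hence faces are incident iff their cosets share an
  element, and two families \<open>\<Gamma>\<^sub>k\<phi>\<close>, \<open>\<Gamma>\<^sub>k\<psi>\<close> that agree at rank \<open>j\<close> can be spliced there. Splicing
  gives transitivity of the order and shows that every chain lies in some \<open>{\<Gamma>\<^sub>k\<phi> | k}\<close>; so these
  are exactly the flags, and they are visibly permuted transitively by right multiplication. The
  intersection property identifies the proper faces of the section between \<open>\<Gamma>\<^sub>i\<phi>\<close> and \<open>\<Gamma>\<^sub>j\<phi>\<close> with the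
  cosets \<open>\<Gamma>\<^sub>kw\<phi>\<close> where \<open>w \<in> \<langle>R\<^sub>m : i < m < j\<rangle>\<close>; writing \<open>w\<close> as a word in the generators connects the
  section. It also gives \<open>R\<^sub>i \<inter> \<Gamma>\<^sub>i = R\<^sub>-\<^sub>1\<close>, so an element of \<open>R\<^sub>i\<close> outside \<open>R\<^sub>-\<^sub>1\<close> supplies the second
  \<open>i\<close>-face between faces of ranks \<open>i - 1\<close> and \<open>i + 1\<close>.\<close>

section \<open>Chains, and products of permuting subgroups\<close>

lemma Chains_comparable: "C \<in> Chains r \<Longrightarrow> x \<in> C \<Longrightarrow> y \<in> C \<Longrightarrow> (x, y) \<in> r \<or> (y, x) \<in> r"
  unfolding Chains_def by blast

lemma Chains_Restr: "Chains (Restr r Q) = {C \<in> Chains r. C \<subseteq> Q}"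
  unfolding Chains_def by auto

text \<open>In a product of \<open>a b\<close> and \<open>c d\<close> the inner pair
  \<open>b c\<close> can be rewritten with its factor from \<open>A\<close> first, and the inverse
  \<open>inv b \<otimes> inv a\<close> likewise, so one inclusion suffices for closure.\<close>

lemma (in group) subgroup_set_mult_permutable:
  assumes A: "subgroup A G" and B: "subgroup B G" and perm: "B <#> A \<subseteq> A <#> B"
  shows "subgroup (A <#> B) G"
proof -
  have sub: "A \<subseteq> carrier G" "B \<subseteq> carrier G"
    using A B by (auto dest: subgroup.subset)
  have one: "\<one> \<in> A" "\<one> \<in> B"
    using A B by (auto dest: subgroup.one_closed)
  have swap: "\<exists>a'\<in>A. \<exists>b'\<in>B. b \<otimes> a = a' \<otimes> b'" if "b \<in> B" "a \<in> A" for a b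
    using perm that unfolding set_mult_def by blast
  show ?thesis
  proof (rule subgroupI)
    show "A <#> B \<subseteq> carrier G" using sub by (rule set_mult_closed)
    show "A <#> B \<noteq> {}" using one unfolding set_mult_def by blast
  next
    fix x assume "x \<in> A <#> B"
    then obtain a b where ab: "a \<in> A" "b \<in> B" "x = a \<otimes> b"
      unfolding set_mult_def by blast
    have "inv x = inv b \<otimes> inv a" using ab sub by (simp add: inv_mult_group subsetD)
    moreover have "inv a \<in> A" "inv b \<in> B"
      using ab A B by (auto dest: subgroup.m_inv_closed)
    ultimately show "inv x \<in> A <#> B"
      using swap unfolding set_mult_def by fastforce
  next
    fix x y assume "x \<in> A <#> B" "y \<in> A <#> B"
    then obtain a b c d where ab: "a \<in> A" "b \<in> B" "x = a \<otimes> b"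
      and cd: "c \<in> A" "d \<in> B" "y = c \<otimes> d"
      unfolding set_mult_def by blast
    obtain a' b' where ab': "a' \<in> A" "b' \<in> B" "b \<otimes> c = a' \<otimes> b'"
      using swap ab cd by blast
    have "x \<otimes> y = a \<otimes> (b \<otimes> c) \<otimes> d"
      using ab cd sub by (simp add: m_assoc subsetD)
    also have "\<dots> = (a \<otimes> a') \<otimes> (b' \<otimes> d)"
      unfolding ab'(3) using ab ab' cd sub by (simp add: m_assoc subsetD)
    finally show "x \<otimes> y \<in> A <#> B"
      using ab ab' cd A B unfolding set_mult_def by (blast intro: subgroup.m_closed)
  qed
qed

text \<open>Inversion exchanges \<open>A <#> B\<close> and \<open>B <#> A\<close>, so an inclusion
  in one direction yields the other.\<close>

lemma (in group) permutable_sym: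
  assumes A: "subgroup A G" and B: "subgroup B G" and perm: "A <#> B \<subseteq> B <#> A"
  shows "B <#> A \<subseteq> A <#> B"
proof
  fix x assume "x \<in> B <#> A"
  then obtain b a where x: "b \<in> B" "a \<in> A" "x = b \<otimes> a" unfolding set_mult_def by blast
  have sub: "A \<subseteq> carrier G" "B \<subseteq> carrier G"
    using A B by (auto dest: subgroup.subset)
  have "inv a \<in> A" "inv b \<in> B"
    using x subgroup.m_inv_closed A B by metis+
  then have "inv a \<otimes> inv b \<in> A <#> B" unfolding set_mult_def by blast
  then have "inv a \<otimes> inv b \<in> B <#> A" using perm by blast
  then obtain b' a' where x': "b' \<in> B" "a' \<in> A" "inv a \<otimes> inv b = b' \<otimes> a'"
    unfolding set_mult_def by blast
  have "x = inv (inv a \<otimes> inv b)" using x sub by (simp add: inv_mult_group subsetD)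
  also have "\<dots> = inv a' \<otimes> inv b'" unfolding x'(3) using x' sub by (simp add: inv_mult_group subsetD)
  finally have "x = inv a' \<otimes> inv b'" .
  moreover have "inv a' \<in> A" "inv b' \<in> B"
    using x' subgroup.m_inv_closed A B by metis+
  ultimately show "x \<in> A <#> B" unfolding set_mult_def by blast
qed

text \<open>An element of \<open>B\<close> moves leftwards past a word one letter at a time. Each
  passage may change it, but it stays in \<open>B\<close>: only the sets permute, the elements need
  not commute.\<close>

lemma (in group) generate_permutable:
  assumes H: "\<And>i. i \<in> I \<Longrightarrow> subgroup (H i) G" and B: "subgroup B G"
    and perm: "\<And>i. i \<in> I \<Longrightarrow> H i <#> B \<subseteq> B <#> H i"
  shows "generate G (\<Union>i\<in>I. H i) <#> B \<subseteq> B <#> generate G (\<Union>i\<in>I. H i)"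
proof -
  let ?A = "generate G (\<Union>i\<in>I. H i)"
  have Hsub: "(\<Union>i\<in>I. H i) \<subseteq> carrier G" using H by (auto dest: subgroup.subset)
  have A: "subgroup ?A G" by (rule generate_is_subgroup[OF Hsub])
  have sub: "?A \<subseteq> carrier G" "B \<subseteq> carrier G"
    using A B by (auto dest: subgroup.subset)
  have step: "\<exists>b'\<in>B. \<exists>a'\<in>?A. a \<otimes> b = b' \<otimes> a'" if "i \<in> I" "a \<in> H i" "b \<in> B" for i a b
  proof -
    have "a \<otimes> b \<in> H i <#> B" using that unfolding set_mult_def by blast
    then have "a \<otimes> b \<in> B <#> H i" using perm[OF that(1)] by blast
    then show ?thesis
      using that(1) unfolding set_mult_def by (blast intro: generate.incl)
  qed
  have swap: "\<forall>b\<in>B. \<exists>b'\<in>B. \<exists>a'\<in>?A. a \<otimes> b = b' \<otimes> a'" if "a \<in> ?A" for a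
    using that
  proof (induction rule: generate.induct)
    case one
    then show ?case
      using sub by (metis generate.one l_one r_one subsetD)
  next
    case (incl h)
    then show ?case using step by blast
  next
    case (inv h)
    then show ?case using step H by (blast dest: subgroup.m_inv_closed)
  next
    case (eng h1 h2)
    show ?case
    proof
      fix b assume b: "b \<in> B"
      obtain b' a' where 1: "b' \<in> B" "a' \<in> ?A" "h2 \<otimes> b = b' \<otimes> a'" using eng b by blast
      obtain b'' a'' where 2: "b'' \<in> B" "a'' \<in> ?A" "h1 \<otimes> b' = b'' \<otimes> a''" using eng 1 by blast
      have "h1 \<otimes> h2 \<otimes> b = (h1 \<otimes> b') \<otimes> a'"
        using eng b 1 sub by (simp add: m_assoc subsetD)
      also have "\<dots> = b'' \<otimes> (a'' \<otimes> a')"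
        unfolding 2(3) using 1 2 sub by (simp add: m_assoc subsetD)
      finally show "\<exists>b'\<in>B. \<exists>a'\<in>?A. h1 \<otimes> h2 \<otimes> b = b' \<otimes> a'"
        using 1 2 by (blast intro: generate.eng)
    qed
  qed
  show ?thesis
  proof
    fix x assume "x \<in> ?A <#> B"
    then obtain a b where "a \<in> ?A" "b \<in> B" "x = a \<otimes> b" unfolding set_mult_def by blast
    then show "x \<in> B <#> ?A" using swap[of a] unfolding set_mult_def by fastforce
  qed
qed

lemma (in group) r_coset_eq_iff:
  assumes "subgroup H G" "x \<in> carrier G" "y \<in> carrier G"
  shows "H #> x = H #> y \<longleftrightarrow> x \<otimes> inv y \<in> H"
  using assms by (metis group_axioms rcos_self repr_independence subgroup.rcos_module)

lemma (in group) set_mult_subset_absorb: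
  assumes "subgroup A G" "subgroup B G" "A \<subseteq> B"
  shows "A <#> B = B" "B <#> A = B"
proof -
  have one: "\<one> \<in> A" and sub: "B \<subseteq> carrier G"
    using assms by (auto dest: subgroup.one_closed subgroup.subset)
  show "A <#> B = B"
  proof
    show "A <#> B \<subseteq> B"
      using assms unfolding set_mult_def by (blast intro: subgroup.m_closed)
    show "B \<subseteq> A <#> B"
      using one sub unfolding set_mult_def by (force intro: l_one[symmetric])
  qed
  show "B <#> A = B"
  proof
    show "B <#> A \<subseteq> B"
      using assms unfolding set_mult_def by (blast intro: subgroup.m_closed)
    show "B \<subseteq> B <#> A"
      using one sub unfolding set_mult_def by (force intro: r_one[symmetric])
  qed
qed

section \<open>Generated subgroups\<close>

context generalized_C_group
begin

abbreviation "\<N> \<equiv> {-1..int n}"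

lemma R_subset_carrier: "i \<in> \<N> \<Longrightarrow> R i \<subseteq> carrier G"
  by (intro subgroup.subset subgroup_R)

lemma R_base_subset:
  assumes "i \<in> \<N>" shows "R (-1) \<subseteq> R i"
proof -
  consider "i = -1" | "i = int n" | "i \<in> {0..int n - 1}" using assms by fastforce
  then show ?thesis using R_last R_proper by cases auto
qed

lemma Gam_subgroup:
  assumes "I \<subseteq> \<N>" shows "subgroup (Gam G R I) G"
proof (cases "I = {}")
  case True
  then show ?thesis using subgroup_R[of "-1"] by (simp add: Gam_def)
next
  case False
  have "(\<Union>i\<in>I. R i) \<subseteq> carrier G"
    using assms by (intro UN_least R_subset_carrier) (rule subsetD)
  then show ?thesis using False by (simp add: Gam_def generate_is_subgroup)
qed

lemma R_subset_Gam: "i \<in> I \<Longrightarrow> R i \<subseteq> Gam G R I"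
  unfolding Gam_def by (auto intro: generate.incl)

lemma R_base_subset_Gam:
  assumes "I \<subseteq> \<N>" shows "R (-1) \<subseteq> Gam G R I"
proof (cases "I = {}")
  case True
  then show ?thesis by (simp add: Gam_def)
next
  case False
  then obtain i where "i \<in> I" by blast
  then show ?thesis using assms R_base_subset[of i] R_subset_Gam[of i I] by (meson order_trans subsetD)
qed

text \<open>The hypothesis on \<open>R (-1)\<close> serves the case of empty \<open>I\<close>, where
  \<open>Gam\<close> is \<open>R (-1)\<close> rather than the trivial subgroup.\<close>

lemma Gam_least:
  assumes "subgroup H G" "R (-1) \<subseteq> H" "\<And>i. i \<in> I \<Longrightarrow> R i \<subseteq> H"
  shows "Gam G R I \<subseteq> H"
proof -
  have "(\<Union>i\<in>I. R i) \<subseteq> H" using assms(3) by (rule UN_least)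
  then have "generate G (\<Union>i\<in>I. R i) \<subseteq> H" using assms(1) by (rule generate_subgroup_incl)
  then show ?thesis using assms(2) by (simp add: Gam_def)
qed

lemma Gam_mono:
  assumes "I \<subseteq> J" "J \<subseteq> \<N>" shows "Gam G R I \<subseteq> Gam G R J"
  using assms by (intro Gam_least Gam_subgroup R_base_subset_Gam R_subset_Gam) (auto dest: subsetD)

lemma Gam_singleton:
  assumes "i \<in> \<N>" shows "Gam G R {i} = R i"
proof
  show "Gam G R {i} \<subseteq> R i"
    by (rule Gam_least) (use subgroup_R[OF assms] R_base_subset[OF assms] in auto)
  show "R i \<subseteq> Gam G R {i}" by (rule R_subset_Gam) simp
qed

lemma Gam_del_subgroup: "subgroup (Gam_del G n R i) G"
  unfolding Gam_del_def by (rule Gam_subgroup) auto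

text \<open>Omitting an end index costs nothing: the omitted subgroup equals \<open>R (-1)\<close>,
  which is contained in the group generated by the others. Hence each improper rank carries a single
  face.\<close>

lemma Gam_del_improper:
  assumes "i = -1 \<or> i = int n"
  shows "Gam_del G n R i = carrier G"
proof -
  have "R j \<subseteq> Gam_del G n R i" if "j \<in> \<N>" for j
    using that assms R_last R_subset_Gam[of j "\<N> - {i}"] R_base_subset_Gam[of "\<N> - {i}"]
    unfolding Gam_del_def by (cases "j = i") auto
  then have "generate G (\<Union>j\<in>\<N>. R j) \<subseteq> Gam_del G n R i"
    using Gam_del_subgroup by (intro generate_subgroup_incl) blast+
  then show ?thesis
    using generating Gam_del_subgroup subgroup.subset by blast
qed

end

section \<open>Permutability along the string\<close>

context generalized_string_C_group
begin

lemma R_permutable: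
  assumes "i \<in> \<N>" "j \<in> \<N>" "2 \<le> \<bar>i - j\<bar>"
  shows "R i <#> R j \<subseteq> R j <#> R i"
proof (cases "i < j")
  case True
  then show ?thesis using string_property[of i j] assms by auto
next
  case False
  then show ?thesis using string_property[of j i] assms by auto
qed

text \<open>\<open>generate_permutable\<close> is applied twice: first to the generators over
  \<open>J\<close> against a single \<open>R i\<close>, then, after exchanging sides by
  \<open>permutable_sym\<close>, to the generators over \<open>I\<close>. Empty index sets are
  treated apart because there \<open>Gam\<close> is not given by \<open>generate\<close>.\<close>

lemma Gam_permutable:
  assumes I: "I \<subseteq> \<N>" and J: "J \<subseteq> \<N>" and sep: "\<And>i j. i \<in> I \<Longrightarrow> j \<in> J \<Longrightarrow> 2 \<le> \<bar>i - j\<bar>"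
  shows "Gam G R I <#> Gam G R J \<subseteq> Gam G R J <#> Gam G R I"
proof -
  have perm1: "Gam G R I' <#> R j \<subseteq> R j <#> Gam G R I'"
    if "I' \<subseteq> \<N>" "I' \<noteq> {}" "j \<in> \<N>" "\<And>i. i \<in> I' \<Longrightarrow> 2 \<le> \<bar>i - j\<bar>" for I' j
  proof -
    have "generate G (\<Union>i\<in>I'. R i) <#> R j \<subseteq> R j <#> generate G (\<Union>i\<in>I'. R i)"
      using that by (intro generate_permutable subgroup_R R_permutable) auto
    then show ?thesis using that(2) by (simp add: Gam_def)
  qed
  have base: "Gam G R K <#> Gam G R {} = Gam G R K" "Gam G R {} <#> Gam G R K = Gam G R K"
    if "K \<subseteq> \<N>" for K
    using that by (intro set_mult_subset_absorb Gam_subgroup Gam_mono; simp)+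
  consider "I = {}" | "J = {}" | "I \<noteq> {}" "J \<noteq> {}" by blast
  then show ?thesis
  proof cases
    case 3
    have "R i <#> Gam G R J \<subseteq> Gam G R J <#> R i" if "i \<in> I" for i
    proof (rule permutable_sym)
      have i: "i \<in> \<N>" using that I by blast
      show "subgroup (Gam G R J) G" "subgroup (R i) G"
        using Gam_subgroup[OF J] subgroup_R[OF i] by blast+
      have "2 \<le> \<bar>j - i\<bar>" if "j \<in> J" for j
        using sep[OF \<open>i \<in> I\<close> that] by linarith
      then show "Gam G R J <#> R i \<subseteq> R i <#> Gam G R J"
        by (rule perm1[OF J 3(2) i])
    qed
    then have "generate G (\<Union>i\<in>I. R i) <#> Gam G R J \<subseteq> Gam G R J <#> generate G (\<Union>i\<in>I. R i)"
      using I by (intro generate_permutable subgroup_R Gam_subgroup[OF J]) blast+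
    then show ?thesis using 3 by (simp add: Gam_def)
  qed (use base[OF I] base[OF J] in auto)
qed

text \<open>By permutability the product is itself a subgroup, and it contains all the
  generators.\<close>

lemma Gam_Un_separated:
  assumes I: "I \<subseteq> \<N>" and J: "J \<subseteq> \<N>" and sep: "\<And>i j. i \<in> I \<Longrightarrow> j \<in> J \<Longrightarrow> 2 \<le> \<bar>i - j\<bar>"
  shows "Gam G R (I \<union> J) \<subseteq> Gam G R I <#> Gam G R J"
proof (rule Gam_least)
  have S: "subgroup (Gam G R I) G" "subgroup (Gam G R J) G" using I J by (auto intro: Gam_subgroup)
  have sub: "Gam G R I \<subseteq> carrier G" "Gam G R J \<subseteq> carrier G"
    using S by (auto dest: subgroup.subset)
  have one: "\<one> \<in> Gam G R I" "\<one> \<in> Gam G R J"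
    using S by (auto dest: subgroup.one_closed)
  show "subgroup (Gam G R I <#> Gam G R J) G"
  proof (rule subgroup_set_mult_permutable[OF S])
    have "2 \<le> \<bar>j - i\<bar>" if "j \<in> J" "i \<in> I" for i j
      using sep[OF that(2,1)] by linarith
    then show "Gam G R J <#> Gam G R I \<subseteq> Gam G R I <#> Gam G R J"
      by (rule Gam_permutable[OF J I])
  qed
  have l: "Gam G R I \<subseteq> Gam G R I <#> Gam G R J"
    using one sub unfolding set_mult_def by (force intro: r_one[symmetric])
  have r: "Gam G R J \<subseteq> Gam G R I <#> Gam G R J"
    using one sub unfolding set_mult_def by (force intro: l_one[symmetric])
  show "R (-1) \<subseteq> Gam G R I <#> Gam G R J" using R_base_subset_Gam[OF I] l by blast
  show "R i \<subseteq> Gam G R I <#> Gam G R J" if "i \<in> I \<union> J" for i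
    using that R_subset_Gam l r by blast
qed

text \<open>Deleting \<open>i\<close> cuts the string into two pieces whose nearest indices
  \<open>i - 1\<close> and \<open>i + 1\<close> are exactly two apart.\<close>

lemma Gam_del_decompose:
  assumes "i \<in> \<N>"
  shows "Gam_del G n R i \<subseteq> Gam_plus G n R (i + 1) <#> Gam_minus G R (i - 1)"
proof -
  have "\<N> - {i} = {i + 1..int n} \<union> {-1..i - 1}" using assms by auto
  then show ?thesis
    unfolding Gam_del_def Gam_plus_def Gam_minus_def
    using Gam_Un_separated[of "{i + 1..int n}" "{-1..i - 1}"] assms by auto
qed

text \<open>All generators used on the left have index above \<open>j\<close>. So multiplying a
  representative on the left by such an element keeps every face of rank at most \<open>j\<close>;
  the next lemma is the mirror image.\<close>

lemma Gam_plus_subset_del: "i \<in> \<N> \<Longrightarrow> i \<le> j \<Longrightarrow> Gam_plus G n R (j + 1) \<subseteq> Gam_del G n R i"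
  unfolding Gam_plus_def Gam_del_def by (rule Gam_mono) auto

lemma Gam_minus_subset_del: "k \<in> \<N> \<Longrightarrow> j \<le> k \<Longrightarrow> Gam_minus G R (j - 1) \<subseteq> Gam_del G n R k"
  unfolding Gam_minus_def Gam_del_def by (rule Gam_mono) auto

section \<open>Incidence\<close>

abbreviation "face \<equiv> K_face G n R"
abbreviation "faces \<equiv> K_faces G n R"
abbreviation "incid \<equiv> K_order G n R"

lemma face_eq_iff:
  "\<phi> \<in> carrier G \<Longrightarrow> \<psi> \<in> carrier G \<Longrightarrow>
   face i \<phi> = face j \<psi> \<longleftrightarrow> i = j \<and> \<phi> \<otimes> inv \<psi> \<in> Gam_del G n R i"
  unfolding K_face_def using r_coset_eq_iff[OF Gam_del_subgroup] by auto

lemma fst_face [simp]: "fst (face i \<phi>) = i"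
  by (simp add: K_face_def)

lemma face_mult:
  assumes "\<phi> \<in> carrier G" "g \<in> Gam_del G n R i"
  shows "face i (g \<otimes> \<phi>) = face i \<phi>"
proof -
  have "g \<in> carrier G" using assms(2) Gam_del_subgroup subgroup.subset by blast
  then show ?thesis using assms by (simp add: face_eq_iff m_assoc)
qed

lemma face_improper:
  "i = -1 \<or> i = int n \<Longrightarrow> \<phi> \<in> carrier G \<Longrightarrow> \<psi> \<in> carrier G \<Longrightarrow> face i \<phi> = face i \<psi>"
  by (simp add: face_eq_iff Gam_del_improper)

text \<open>Writing \<open>\<phi>\<close> as \<open>v \<otimes> (u \<otimes> \<psi>)\<close>, the
  element \<open>u \<otimes> \<psi>\<close> serves as \<open>\<chi>\<close>: the factor
  \<open>v\<close> does not affect faces of rank at most \<open>i\<close>, and \<open>u\<close> does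
  not affect those of rank at least \<open>j\<close>.\<close>

lemma glue_mult:
  assumes "\<phi> \<in> carrier G" "\<psi> \<in> carrier G" "i \<in> \<N>" "j \<in> \<N>"
    and "\<phi> \<otimes> inv \<psi> \<in> Gam_plus G n R (i + 1) <#> Gam_minus G R (j - 1)"
  obtains \<chi> where "\<chi> \<in> carrier G" "\<And>k. k \<in> \<N> \<Longrightarrow> k \<le> i \<Longrightarrow> face k \<chi> = face k \<phi>"
    "\<And>k. k \<in> \<N> \<Longrightarrow> j \<le> k \<Longrightarrow> face k \<chi> = face k \<psi>"
proof -
  obtain v u where vu: "v \<in> Gam_plus G n R (i + 1)" "u \<in> Gam_minus G R (j - 1)"
      "\<phi> \<otimes> inv \<psi> = v \<otimes> u"
    using assms(5) unfolding set_mult_def by blast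
  have c: "v \<in> carrier G" "u \<in> carrier G"
    using vu assms Gam_plus_subset_del[of i i] Gam_minus_subset_del[of j j]
      subgroup.subset[OF Gam_del_subgroup] by blast+
  have "\<phi> = v \<otimes> (u \<otimes> \<psi>)"
    using vu(3) assms c by (metis inv_closed inv_solve_right m_assoc m_closed)
  then have "face k (u \<otimes> \<psi>) = face k \<phi>" if "k \<in> \<N>" "k \<le> i" for k
    using face_mult[of "u \<otimes> \<psi>" v k] Gam_plus_subset_del[OF that] vu c assms by auto
  moreover have "face k (u \<otimes> \<psi>) = face k \<psi>" if "k \<in> \<N>" "j \<le> k" for k
    using face_mult[of "\<psi>" u k] Gam_minus_subset_del[OF that] vu assms by auto
  ultimately show ?thesis using that[of "u \<otimes> \<psi>"] c assms by auto
qed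

text \<open>Two families of mutually incident faces that share their \<open>j\<close>-face can be spliced at rank \<open>j\<close>.\<close>

lemma glue:
  assumes "\<phi> \<in> carrier G" "\<psi> \<in> carrier G" "j \<in> \<N>" "face j \<phi> = face j \<psi>"
  obtains \<chi> where "\<chi> \<in> carrier G" "\<And>k. k \<in> \<N> \<Longrightarrow> k \<le> j \<Longrightarrow> face k \<chi> = face k \<phi>"
    "\<And>k. k \<in> \<N> \<Longrightarrow> j \<le> k \<Longrightarrow> face k \<chi> = face k \<psi>"
proof (rule glue_mult[OF assms(1,2,3,3)])
  show "\<phi> \<otimes> inv \<psi> \<in> Gam_plus G n R (j + 1) <#> Gam_minus G R (j - 1)"
    using assms Gam_del_decompose[of j] by (auto simp: face_eq_iff)
qed (use that in blast)

lemma incid_face: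
  assumes "\<phi> \<in> carrier G" "i \<in> \<N>" "j \<in> \<N>" "i \<le> j"
  shows "(face i \<phi>, face j \<phi>) \<in> incid"
proof -
  have "\<one> \<in> Gam_plus G n R (i + 1)" "\<one> \<in> Gam_minus G R (j - 1)"
    unfolding Gam_plus_def Gam_minus_def
    using assms by (auto intro!: subgroup.one_closed Gam_subgroup)
  then have "\<one> \<in> Gam_plus G n R (i + 1) <#> Gam_minus G R (j - 1)"
    unfolding set_mult_def by (force intro: l_one[symmetric])
  then show ?thesis unfolding K_order_def using assms by force
qed

text \<open>The product condition in \<open>K_order\<close> becomes the existence of a common
  representative. Together with \<open>incid_face\<close> this characterises incidence, and later
  arguments use only this form.\<close>

lemma incidE:
  assumes "(F, H) \<in> incid"
  obtains i j \<phi> where "F = face i \<phi>" "H = face j \<phi>" "i \<in> \<N>" "j \<in> \<N>" "i \<le> j" "\<phi> \<in> carrier G"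
proof -
  obtain i j \<phi> \<psi> where *: "F = face i \<phi>" "H = face j \<psi>" "i \<in> \<N>" "j \<in> \<N>" "i \<le> j"
    "\<phi> \<in> carrier G" "\<psi> \<in> carrier G" "\<phi> \<otimes> inv \<psi> \<in> Gam_plus G n R (i + 1) <#> Gam_minus G R (j - 1)"
    using assms unfolding K_order_def by auto
  show ?thesis
  proof (rule glue_mult[OF *(6,7,3,4,8)])
    fix \<chi> assume "\<chi> \<in> carrier G" "\<And>k. k \<in> \<N> \<Longrightarrow> k \<le> i \<Longrightarrow> face k \<chi> = face k \<phi>"
      "\<And>k. k \<in> \<N> \<Longrightarrow> j \<le> k \<Longrightarrow> face k \<chi> = face k \<psi>"
    then show ?thesis using that[of i \<chi> j] * by auto
  qed
qed

lemma face_in_faces: "i \<in> \<N> \<Longrightarrow> \<phi> \<in> carrier G \<Longrightarrow> face i \<phi> \<in> faces"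
  unfolding K_faces_def by blast

lemma facesE:
  assumes "F \<in> faces" obtains i \<phi> where "F = face i \<phi>" "i \<in> \<N>" "\<phi> \<in> carrier G"
  using assms unfolding K_faces_def by blast

lemma incid_fst_eq: "(F, H) \<in> incid \<Longrightarrow> fst F = fst H \<Longrightarrow> F = H"
  by (auto elim: incidE)

lemma incid_fst_le: "(F, H) \<in> incid \<Longrightarrow> fst F \<le> fst H"
  by (auto elim: incidE)

lemma incid_antisym: "(F, H) \<in> incid \<Longrightarrow> (H, F) \<in> incid \<Longrightarrow> F = H"
  by (meson antisym incid_fst_eq incid_fst_le)

lemma incid_trans: 
  assumes "(E, F) \<in> incid" "(F, H) \<in> incid" shows "(E, H) \<in> incid"
proof -
  obtain i j \<phi> where 1: "E = face i \<phi>" "F = face j \<phi>" "i \<in> \<N>" "j \<in> \<N>" "i \<le> j" "\<phi> \<in> carrier G"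
    using assms(1) by (rule incidE)
  obtain j' k \<psi> where 2: "F = face j' \<psi>" "H = face k \<psi>" "j' \<in> \<N>" "k \<in> \<N>" "j' \<le> k" "\<psi> \<in> carrier G"
    using assms(2) by (rule incidE)
  have j: "j' = j" using 1 2 by (metis fst_face)
  obtain \<chi> where "\<chi> \<in> carrier G" "\<And>k. k \<in> \<N> \<Longrightarrow> k \<le> j \<Longrightarrow> face k \<chi> = face k \<phi>"
    "\<And>k. k \<in> \<N> \<Longrightarrow> j \<le> k \<Longrightarrow> face k \<chi> = face k \<psi>"
    using glue[of \<phi> \<psi> j] 1 2 j by metis
  then show ?thesis using incid_face[of \<chi> i k] 1 2 j by simp
qed

lemma partial_order_incid: "partial_order_on faces incid"
proof -
  have "incid \<subseteq> faces \<times> faces" by (auto elim!: incidE intro!: face_in_faces)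
  moreover have "refl_on faces incid"
    by (rule refl_onI) (auto elim!: facesE intro!: incid_face)
  moreover have "trans incid" by (rule transI) (rule incid_trans)
  moreover have "antisym incid" by (rule antisymI) (rule incid_antisym)
  ultimately show ?thesis by (simp add: partial_order_on_def preorder_on_def)
qed

section \<open>Chains, flags and sections\<close>

abbreviation "flag \<phi> I \<equiv> (\<lambda>k. face k \<phi>) ` I"

lemma incid_fst_range: "(F, H) \<in> incid \<Longrightarrow> fst F \<in> \<N> \<and> fst H \<in> \<N>"
  by (auto elim: incidE)

lemma chain_inj_fst: "C \<in> Chains incid \<Longrightarrow> inj_on fst C"
  by (rule inj_onI) (metis Chains_comparable[of C incid] incid_fst_eq)

text \<open>Ranks are distinct along a chain and lie in a finite set, so induction over finite
  chains reaches every chain.\<close>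

lemma chain_finite:
  assumes "C \<in> Chains incid" shows "finite C"
proof (rule finite_imageD[OF _ chain_inj_fst[OF assms]])
  have "fst ` C \<subseteq> \<N>" using Chains_comparable[OF assms] incid_fst_range by blast
  then show "finite (fst ` C)" by (rule finite_subset) simp
qed

lemma face_in_flag:
  assumes "face k \<psi> \<in> flag \<phi> I" shows "face k \<phi> = face k \<psi> \<and> k \<in> I"
proof -
  obtain l where l: "l \<in> I" "face k \<psi> = face l \<phi>" using assms by blast
  then have "k = l" using fst_face by metis
  then show ?thesis using l by simp
qed

lemma finite_chain_subset_flag:
  assumes "finite C" "C \<in> Chains incid"
  shows "\<exists>\<phi>\<in>carrier G. C \<subseteq> flag \<phi> \<N>"
  using assms
\<comment> \<open>This induction inserts faces in order of rank: the new face \<open>F\<close> has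
  rank at least that of every face in \<open>S\<close>.\<close>
proof (induction rule: finite_ranking_induct[where f = fst])
  case empty
  then show ?case by blast
next
  case (insert F S)
  have chain: "(x, y) \<in> incid \<or> (y, x) \<in> incid" if "x \<in> insert F S" "y \<in> insert F S" for x y
    using insert.prems that by (rule Chains_comparable)
  then have "S \<in> Chains incid" unfolding Chains_def by blast
  then obtain \<phi> where \<phi>: "\<phi> \<in> carrier G" "S \<subseteq> flag \<phi> \<N>" using insert.IH by blast
  show ?case
  proof (cases "S = {}")
    case True
    have "(F, F) \<in> incid" using chain by blast
    then obtain i \<psi> where "F = face i \<psi>" "i \<in> \<N>" "\<psi> \<in> carrier G" by (rule incidE) auto
    then show ?thesis using True by blast
  next
    case False
    \<comment> \<open>The top face \<open>H\<close> of \<open>S\<close> lies below \<open>F\<close>.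
      The flag containing \<open>S\<close> is spliced at \<open>H\<close> with one containing both
      \<open>H\<close> and \<open>F\<close>.\<close>
    then have "Max (fst ` S) \<in> fst ` S" using insert.hyps by simp
    then obtain H where H: "H \<in> S" "Max (fst ` S) = fst H" by blast
    have max: "fst E \<le> fst H" if "E \<in> S" for E
      using that insert.hyps by (simp flip: H(2))
    have "(H, F) \<in> incid"
      using chain[of H F] H insert.hyps(2)[OF H(1)] incid_fst_eq incid_fst_le
      by (metis insertCI order_antisym)
    then obtain i j \<chi> where c: "H = face i \<chi>" "F = face j \<chi>" "i \<in> \<N>" "j \<in> \<N>" "i \<le> j" "\<chi> \<in> carrier G"
      by (rule incidE)
    have "H = face i \<phi>" using face_in_flag[of i \<chi> \<phi> \<N>] H(1) \<phi>(2) c(1) by auto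
    then obtain \<eta> where \<eta>: "\<eta> \<in> carrier G" "\<And>k. k \<in> \<N> \<Longrightarrow> k \<le> i \<Longrightarrow> face k \<eta> = face k \<phi>"
      "\<And>k. k \<in> \<N> \<Longrightarrow> i \<le> k \<Longrightarrow> face k \<eta> = face k \<chi>"
      using glue[of \<phi> \<chi> i] c \<phi> by metis
    have "E \<in> flag \<eta> \<N>" if E: "E \<in> S" for E
    proof -
      obtain k where k: "k \<in> \<N>" "E = face k \<phi>" using \<phi>(2) E by blast
      moreover have "k \<le> i" using max[OF E] k c by simp
      ultimately show ?thesis using \<eta>(2) by (metis imageI)
    qed
    moreover have "F \<in> flag \<eta> \<N>" using \<eta>(3) c by (metis imageI)
    ultimately show ?thesis using \<eta>(1) by blast
  qed
qed

lemma flag_chain: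
  assumes "\<phi> \<in> carrier G" "I \<subseteq> \<N>" shows "flag \<phi> I \<in> Chains incid"
proof -
  have "(x, y) \<in> incid \<or> (y, x) \<in> incid" if xy: "x \<in> flag \<phi> I" "y \<in> flag \<phi> I" for x y
  proof -
    obtain k l where "k \<in> \<N>" "l \<in> \<N>" "x = face k \<phi>" "y = face l \<phi>" using xy assms(2) by blast
    then show ?thesis
      using incid_face[of \<phi> k l] incid_face[of \<phi> l k] assms(1) linear[of k l] by blast
  qed
  then show ?thesis unfolding Chains_def by blast
qed

lemma card_flag: "card (flag \<phi> I) = card I"
  by (rule card_image) (metis fst_face inj_onI)

section \<open>Sections between two incident faces\<close>

context
  fixes i j \<phi>
  assumes ij: "i \<in> \<N>" "j \<in> \<N>" "i \<le> j" and \<phi>: "\<phi> \<in> carrier G"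
begin

text \<open>By \<open>incidE\<close> one \<open>\<phi>\<close> can represent both ends of a section;
  \<open>through\<close> selects the representatives whose flags contain both ends.\<close>

abbreviation "sect \<equiv> section_of faces incid (face i \<phi>) (face j \<phi>)"
abbreviation "through \<psi> \<equiv> \<psi> \<in> carrier G \<and> face i \<psi> = face i \<phi> \<and> face j \<psi> = face j \<phi>"

lemma sect_iff: "H \<in> sect \<longleftrightarrow> (\<exists>k\<in>{i..j}. \<exists>\<psi>. H = face k \<psi> \<and> through \<psi>)"
proof
  assume "H \<in> sect"
  then have H: "(face i \<phi>, H) \<in> incid" "(H, face j \<phi>) \<in> incid" by (auto simp: section_of_def)
  obtain i' k \<alpha> where a: "face i \<phi> = face i' \<alpha>" "H = face k \<alpha>" "k \<in> \<N>" "i' \<le> k" "\<alpha> \<in> carrier G"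
    using H(1) by (rule incidE)
  obtain k' j' \<beta> where b: "H = face k' \<beta>" "face j \<phi> = face j' \<beta>" "k' \<le> j'" "\<beta> \<in> carrier G"
    using H(2) by (rule incidE)
  have eq: "i' = i" "k' = k" "j' = j" using a b by (metis fst_face)+
  \<comment> \<open>A flag containing the lower end and \<open>H\<close> is spliced at
    \<open>H\<close> with one containing \<open>H\<close> and the upper end.\<close>
  obtain \<eta> where \<eta>: "\<eta> \<in> carrier G" "\<And>l. l \<in> \<N> \<Longrightarrow> l \<le> k \<Longrightarrow> face l \<eta> = face l \<alpha>"
      "\<And>l. l \<in> \<N> \<Longrightarrow> k \<le> l \<Longrightarrow> face l \<eta> = face l \<beta>"
    using glue[of \<alpha> \<beta> k] a b eq by metis
  have "through \<eta>" "H = face k \<eta>" using \<eta> a b ij eq by auto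
  then show "\<exists>k\<in>{i..j}. \<exists>\<psi>. H = face k \<psi> \<and> through \<psi>"
    using a b eq by (intro bexI[of _ k]) auto
next
  assume "\<exists>k\<in>{i..j}. \<exists>\<psi>. H = face k \<psi> \<and> through \<psi>"
  then obtain k \<psi> where "k \<in> {i..j}" "H = face k \<psi>" "through \<psi>" by blast
  then show "H \<in> sect"
    unfolding section_of_def using ij incid_face[of \<psi> i k] incid_face[of \<psi> k j]
    by (auto intro: face_in_faces)
qed

lemma sect_chain_subset:
  assumes "C \<in> Chains (Restr incid sect)"
  obtains \<psi> where "through \<psi>" "C \<subseteq> flag \<psi> {i..j}"
proof -
  have C: "C \<in> Chains incid" "C \<subseteq> sect" using assms by (auto simp: Chains_Restr)
  \<comment> \<open>Adjoining both ends forces the enclosing flag to pass through them.\<close>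
  let ?D = "insert (face i \<phi>) (insert (face j \<phi>) C)"
  have "(face i \<phi>, H) \<in> incid" "(H, face j \<phi>) \<in> incid" if "H \<in> C" for H
    using C(2) that by (auto simp: section_of_def)
  then have "?D \<in> Chains incid"
    using C(1) incid_face[of \<phi> i i] incid_face[of \<phi> j j] incid_face[of \<phi> i j] ij \<phi>
    unfolding Chains_def by auto
  then obtain \<psi> where \<psi>: "\<psi> \<in> carrier G" "?D \<subseteq> flag \<psi> \<N>"
    using finite_chain_subset_flag chain_finite by blast
  have "through \<psi>" using \<psi> face_in_flag by blast
  moreover have "C \<subseteq> flag \<psi> {i..j}"
  proof
    fix H assume "H \<in> C"
    then obtain k \<chi> where H: "k \<in> {i..j}" "H = face k \<chi>" using C(2) sect_iff by blast
    then have "face k \<psi> = face k \<chi>" using \<open>H \<in> C\<close> \<psi>(2) face_in_flag by blast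
    then show "H \<in> flag \<psi> {i..j}" using H by (metis imageI)
  qed
  ultimately show ?thesis by (rule that)
qed

lemma sect_flag_chain:
  assumes "through \<psi>" shows "flag \<psi> {i..j} \<in> Chains (Restr incid sect)"
proof -
  have "flag \<psi> {i..j} \<subseteq> sect" using assms sect_iff by blast
  moreover have "flag \<psi> {i..j} \<in> Chains incid" using flag_chain[of \<psi> "{i..j}"] assms ij by auto
  ultimately show ?thesis by (simp add: Chains_Restr)
qed

lemma flags_sect: "flags (Restr incid sect) = {flag \<psi> {i..j} | \<psi>. through \<psi>}"
proof (intro equalityI subsetI)
  fix C assume C: "C \<in> flags (Restr incid sect)"
  then obtain \<psi> where \<psi>: "through \<psi>" "C \<subseteq> flag \<psi> {i..j}"
    using sect_chain_subset[of C] unfolding flags_def by blast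
  then have "flag \<psi> {i..j} = C"
    using C sect_flag_chain[OF \<psi>(1)] unfolding flags_def by blast
  then show "C \<in> {flag \<psi> {i..j} | \<psi>. through \<psi>}" using \<psi>(1) by blast
next
  fix C assume "C \<in> {flag \<psi> {i..j} | \<psi>. through \<psi>}"
  then obtain \<psi> where C: "C = flag \<psi> {i..j}" and \<psi>: "through \<psi>" by blast
  have "D = C" if D: "D \<in> Chains (Restr incid sect)" "C \<subseteq> D" for D
  proof -
    obtain \<chi> where "through \<chi>" "D \<subseteq> flag \<chi> {i..j}" using sect_chain_subset[OF D(1)] by blast
    \<comment> \<open>Both flags have exactly one face in each rank, so \<open>C\<close> lying
      inside \<open>flag \<chi> {i..j}\<close> forces equality, with \<open>D\<close> caught in
      between.\<close>
    moreover from this have "face k \<chi> = face k \<psi>" if "k \<in> {i..j}" for k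
      using D(2) that face_in_flag C by blast
    then have "flag \<chi> {i..j} = C" unfolding C by (rule image_cong[OF refl])
    ultimately show ?thesis using D(2) by blast
  qed
  then show "C \<in> flags (Restr incid sect)"
    using sect_flag_chain[OF \<psi>] unfolding flags_def C by blast
qed

lemma sect_rank: "has_rank (Restr incid sect) k \<longleftrightarrow> k = j - i - 1"
proof -
  have card: "int (card (flag \<psi> {i..j})) = j - i + 1" for \<psi> using card_flag ij by simp
  \<comment> \<open>The existence of a flag keeps \<open>has_rank\<close> from holding vacuously,
    which makes the rank unique.\<close>
  have "flag \<phi> {i..j} \<in> flags (Restr incid sect)" unfolding flags_sect using \<phi> by blast
  then have "k = j - i - 1" if "has_rank (Restr incid sect) k"
    using that card[of \<phi>] unfolding has_rank_def by force
  moreover have "has_rank (Restr incid sect) (j - i - 1)"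
    unfolding has_rank_def
  proof
    fix C assume "C \<in> flags (Restr incid sect)"
    then obtain \<psi> where "C = flag \<psi> {i..j}" unfolding flags_sect by blast
    then show "finite C \<and> int (card C) = j - i - 1 + 2" using card[of \<psi>] by simp
  qed
  ultimately show ?thesis by blast
qed

lemma sect_proper:
  "proper_faces sect (Restr incid sect) = {face k \<psi> | k \<psi>. i < k \<and> k < j \<and> through \<psi>}"
proof -
  have ends: "face i \<phi> \<in> sect" "face j \<phi> \<in> sect"
    using sect_iff ij \<phi> by fastforce+
  have least: "is_least sect (Restr incid sect) H \<longleftrightarrow> H = face i \<phi>" if "H \<in> sect" for H
  proof -
    have "(face i \<phi>, H) \<in> incid" using that by (simp add: section_of_def)
    then have "H = face i \<phi>" if "(H, face i \<phi>) \<in> incid" using incid_antisym that by blast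
    moreover have "(face i \<phi>, E) \<in> Restr incid sect" if "E \<in> sect" for E
      using that ends by (simp add: section_of_def)
    ultimately show ?thesis unfolding is_least_def using that ends by blast
  qed
  have greatest: "is_greatest sect (Restr incid sect) H \<longleftrightarrow> H = face j \<phi>" if "H \<in> sect" for H
  proof -
    have "(H, face j \<phi>) \<in> incid" using that by (simp add: section_of_def)
    then have "H = face j \<phi>" if "(face j \<phi>, H) \<in> incid" using incid_antisym that by blast
    moreover have "(E, face j \<phi>) \<in> Restr incid sect" if "E \<in> sect" for E
      using that ends by (simp add: section_of_def)
    ultimately show ?thesis unfolding is_greatest_def using that ends by blast
  qed
  have eq: "proper_faces sect (Restr incid sect) = {H \<in> sect. H \<noteq> face i \<phi> \<and> H \<noteq> face j \<phi>}"
    unfolding proper_faces_def using least greatest by blast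
  show ?thesis
  proof (intro equalityI subsetI)
    fix H assume "H \<in> proper_faces sect (Restr incid sect)"
    then have H: "H \<in> sect" "H \<noteq> face i \<phi>" "H \<noteq> face j \<phi>" unfolding eq by auto
    then obtain k \<psi> where k: "k \<in> {i..j}" "H = face k \<psi>" "through \<psi>" using sect_iff by blast
    then have "k \<noteq> i" "k \<noteq> j" using H by auto
    then show "H \<in> {face k \<psi> | k \<psi>. i < k \<and> k < j \<and> through \<psi>}" using k by fastforce
  next
    fix H assume "H \<in> {face k \<psi> | k \<psi>. i < k \<and> k < j \<and> through \<psi>}"
    then obtain k \<psi> where k: "i < k" "k < j" "H = face k \<psi>" "through \<psi>" by blast
    then have "H \<in> sect" using sect_iff[of H] by fastforce
    moreover have "H \<noteq> face i \<phi>" "H \<noteq> face j \<phi>" using k by (metis fst_face less_irrefl)+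
    ultimately show "H \<in> proper_faces sect (Restr incid sect)" unfolding eq by blast
  qed
qed

text \<open>Generators of intermediate rank avoid both end ranks, so \<open>w\<close> lies in both
  of the subgroups that define the ends. Conversely, \<open>through_face_rep\<close> shows that
  every proper face of the section arises from such a \<open>w\<close>.\<close>

lemma through_mult:
  assumes "w \<in> Gam G R {i + 1..j - 1}" shows "through (w \<otimes> \<phi>)"
proof -
  have "Gam G R {i + 1..j - 1} \<subseteq> Gam_del G n R i" "Gam G R {i + 1..j - 1} \<subseteq> Gam_del G n R j"
    unfolding Gam_del_def by (rule Gam_mono; use ij in force)+
  then have "w \<in> Gam_del G n R i" "w \<in> Gam_del G n R j" using assms by auto
  moreover from this have "w \<in> carrier G" using subgroup.subset[OF Gam_del_subgroup] by blast
  ultimately show ?thesis using \<phi> by (simp add: face_mult)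
qed

text \<open>The intersection property enters here: an element fixing both end faces of the section
  lies in the subgroup omitting both end ranks, and only its part from the generators of
  intermediate rank matters inside the section.\<close>

lemma through_face_rep:
  assumes \<psi>: "through \<psi>" and k: "i < k" "k < j"
  obtains w where "w \<in> Gam G R {i + 1..j - 1}" "face k \<psi> = face k (w \<otimes> \<phi>)"
proof -
  let ?A = "{-1..i - 1} \<union> {j + 1..int n}" and ?W = "{i + 1..j - 1}"
  have sub: "?A \<subseteq> \<N>" "?W \<subseteq> \<N>" using ij by auto
  have "\<psi> \<otimes> inv \<phi> \<in> Gam_del G n R i \<inter> Gam_del G n R j"
    using \<psi> \<phi> face_eq_iff[of \<psi> \<phi> i i] face_eq_iff[of \<psi> \<phi> j j] by blast
  also have "\<dots> = Gam G R ((\<N> - {i}) \<inter> (\<N> - {j}))"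
    unfolding Gam_del_def by (rule intersection_property) auto
  also have "(\<N> - {i}) \<inter> (\<N> - {j}) = ?A \<union> ?W" using ij k by auto
  \<comment> \<open>The missing indices \<open>i\<close> and \<open>j\<close> keep \<open>?A\<close>
    and \<open>?W\<close> at least two apart.\<close>
  also have "Gam G R (?A \<union> ?W) \<subseteq> Gam G R ?A <#> Gam G R ?W"
    using sub by (rule Gam_Un_separated) auto
  finally obtain a w where aw: "a \<in> Gam G R ?A" "w \<in> Gam G R ?W" "\<psi> \<otimes> inv \<phi> = a \<otimes> w"
    unfolding set_mult_def by blast
  have c: "a \<in> carrier G" "w \<in> carrier G"
    using aw subgroup.subset[OF Gam_subgroup[OF sub(1)]] subgroup.subset[OF Gam_subgroup[OF sub(2)]]
    by auto
  have "Gam G R ?A \<subseteq> Gam_del G n R k"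
    unfolding Gam_del_def by (rule Gam_mono) (use ij k in auto)
  then have "a \<in> Gam_del G n R k" using aw(1) by blast
  moreover have "\<psi> = a \<otimes> (w \<otimes> \<phi>)"
    using aw(3) \<psi> \<phi> c by (metis inv_closed inv_solve_right m_assoc m_closed)
  ultimately have "face k \<psi> = face k (w \<otimes> \<phi>)"
    using c \<phi> by (simp add: face_mult)
  then show ?thesis using aw(2) by (rule that[rotated])
qed

text \<open>Passing from \<open>g\<close> to \<open>h \<otimes> g\<close> with \<open>h \<in> R m\<close> leaves every face of rank other than \<open>m\<close> in
  place; a section of rank at least two has such a proper face.\<close>

lemma sect_connected_step:
  assumes rk: "i + 2 < j" and h: "h \<in> R m" "m \<in> {i + 1..j - 1}" and g: "g \<in> Gam G R {i + 1..j - 1}"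
    and kl: "i < k" "k < j" "i < l" "l < j"
  defines "P \<equiv> proper_faces sect (Restr incid sect)"
  shows "(face k (g \<otimes> \<phi>), face l (h \<otimes> g \<otimes> \<phi>)) \<in> (Restr (incid \<union> incid\<inverse>) P)\<^sup>*"
proof -
  let ?W = "Gam G R {i + 1..j - 1}"
  have W: "subgroup ?W G" using ij by (intro Gam_subgroup) auto
  have adj: "(face p (w \<otimes> \<phi>), face q (w \<otimes> \<phi>)) \<in> Restr (incid \<union> incid\<inverse>) P"
    if w: "w \<in> ?W" and pq: "i < p" "p < j" "i < q" "q < j" for w p q
  proof -
    have t: "through (w \<otimes> \<phi>)" using w by (rule through_mult)
    have "face p (w \<otimes> \<phi>) \<in> P" "face q (w \<otimes> \<phi>) \<in> P"
      unfolding P_def sect_proper using t pq by blast+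
    moreover have "(face p (w \<otimes> \<phi>), face q (w \<otimes> \<phi>)) \<in> incid \<union> incid\<inverse>"
      using incid_face[of "w \<otimes> \<phi>" p q] incid_face[of "w \<otimes> \<phi>" q p] t pq ij
      by (cases "p \<le> q") auto
    ultimately show ?thesis by blast
  qed
  obtain p where p: "i < p" "p < j" "p \<noteq> m"
  proof (cases "m = i + 1")
    case True
    then show ?thesis using that[of "i + 2"] rk by simp
  next
    case False
    then show ?thesis using that[of "i + 1"] rk by simp
  qed
  have hW: "h \<in> ?W" using h R_subset_Gam by blast
  have c: "g \<in> carrier G" "h \<in> carrier G" using subgroup.subset[OF W] g hW by auto
  have "h \<in> Gam_del G n R p"
    unfolding Gam_del_def using R_subset_Gam[of m "\<N> - {p}"] h p ij by auto
  then have eq: "face p (h \<otimes> g \<otimes> \<phi>) = face p (g \<otimes> \<phi>)"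
    using c \<phi> by (simp add: m_assoc face_mult)
  have hg: "h \<otimes> g \<in> ?W" using W hW g by (rule subgroup.m_closed)
  \<comment> \<open>The path runs through the face of rank \<open>p\<close>, which the two flags
    share.\<close>
  have "(face k (g \<otimes> \<phi>), face p (g \<otimes> \<phi>)) \<in> Restr (incid \<union> incid\<inverse>) P"
    using g kl(1,2) p(1,2) by (rule adj)
  moreover have "(face p (g \<otimes> \<phi>), face l (h \<otimes> g \<otimes> \<phi>)) \<in> Restr (incid \<union> incid\<inverse>) P"
    using adj[OF hg p(1,2) kl(3,4)] eq by simp
  ultimately show ?thesis by (meson r_into_rtrancl rtrancl_trans)
qed

text \<open>Paths for the letters of a word for \<open>w\<close> are concatenated. The start
  \<open>g\<close> and both ranks must vary in the induction, since the path for the left factor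
  starts where the path for the right factor ends.\<close>

lemma sect_connected_generated:
  assumes rk: "i + 2 < j" and w: "w \<in> Gam G R {i + 1..j - 1}" and g: "g \<in> Gam G R {i + 1..j - 1}"
    and kl: "i < k" "k < j" "i < l" "l < j"
  defines "P \<equiv> proper_faces sect (Restr incid sect)"
  shows "(face k (g \<otimes> \<phi>), face l (w \<otimes> g \<otimes> \<phi>)) \<in> (Restr (incid \<union> incid\<inverse>) P)\<^sup>*"
proof -
  let ?I = "{i + 1..j - 1}" and ?T = "(Restr (incid \<union> incid\<inverse>) P)\<^sup>*"
  have W: "subgroup (Gam G R ?I) G" using ij by (intro Gam_subgroup) auto
  have gen: "Gam G R ?I = generate G (\<Union>m\<in>?I. R m)" using rk by (simp add: Gam_def)
  have step: "(face k (g \<otimes> \<phi>), face l (h \<otimes> g \<otimes> \<phi>)) \<in> ?T"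
    if "m \<in> ?I" "h \<in> R m" "g \<in> Gam G R ?I" "i < k" "k < j" "i < l" "l < j" for m h g k l
    unfolding P_def using rk that(2,1,3-7) by (rule sect_connected_step)
  have "w \<in> generate G (\<Union>m\<in>?I. R m)" using w gen by simp
  then show ?thesis using g kl
  proof (induction arbitrary: g k l rule: generate.induct)
    case one
    \<comment> \<open>The identity counts as a letter from \<open>R (i + 1)\<close>, so the step
      lemma also covers a mere change of rank.\<close>
    have i1: "i + 1 \<in> ?I" "i + 1 \<in> \<N>" using rk ij by auto
    show ?case
      using step[OF i1(1) _ one] subgroup.one_closed[OF subgroup_R[OF i1(2)]] by simp
  next
    case (incl h)
    then show ?case using step by blast
  next
    case (inv h)
    then obtain m where m: "m \<in> ?I" "h \<in> R m" by blast
    moreover have "m \<in> \<N>" using m ij by auto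
    ultimately have "inv h \<in> R m" using subgroup_R subgroup.m_inv_closed by metis
    then show ?case using step m inv.prems by blast
  next
    case (eng h1 h2)
    have h: "h1 \<in> Gam G R ?I" "h2 \<in> Gam G R ?I" using eng.hyps gen by auto
    have hg: "h2 \<otimes> g \<in> Gam G R ?I" using W h(2) eng.prems(1) by (rule subgroup.m_closed)
    have c: "h1 \<in> carrier G" "h2 \<in> carrier G" "g \<in> carrier G"
      using h eng.prems subgroup.subset[OF W] by auto
    \<comment> \<open>The first leg returns to rank \<open>k\<close>; the second then changes the
      rank to \<open>l\<close>.\<close>
    have "(face k (g \<otimes> \<phi>), face k (h2 \<otimes> g \<otimes> \<phi>)) \<in> ?T"
      using eng.IH(2) eng.prems by blast
    moreover have "(face k (h2 \<otimes> g \<otimes> \<phi>), face l (h1 \<otimes> (h2 \<otimes> g) \<otimes> \<phi>)) \<in> ?T"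
      using eng.IH(1)[OF hg] eng.prems by blast
    ultimately show ?case using c by (simp add: m_assoc)
  qed
qed

lemma sect_connected: "connected_poset sect (Restr incid sect)"
proof -
  let ?P = "proper_faces sect (Restr incid sect)"
  have "(x, y) \<in> (Restr (Restr incid sect \<union> (Restr incid sect)\<inverse>) ?P)\<^sup>*"
    if rk: "i + 2 < j" and xy: "x \<in> ?P" "y \<in> ?P" for x y
  proof -
    let ?W = "Gam G R {i + 1..j - 1}"
    have W: "subgroup ?W G" using ij by (intro Gam_subgroup) auto
    have rep: "\<exists>k w. i < k \<and> k < j \<and> w \<in> ?W \<and> z = face k (w \<otimes> \<phi>)" if "z \<in> ?P" for z
    proof -
      obtain k \<psi> where z: "z = face k \<psi>" "i < k" "k < j" "through \<psi>"
        using \<open>z \<in> ?P\<close> unfolding sect_proper by blast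
      obtain w where "w \<in> ?W" "face k \<psi> = face k (w \<otimes> \<phi>)"
        using z(4,2,3) by (rule through_face_rep)
      then show ?thesis using z by blast
    qed
    obtain k w where x: "i < k" "k < j" "w \<in> ?W" "x = face k (w \<otimes> \<phi>)" using rep[OF xy(1)] by blast
    obtain l w' where y: "i < l" "l < j" "w' \<in> ?W" "y = face l (w' \<otimes> \<phi>)" using rep[OF xy(2)] by blast
    have c: "w \<in> carrier G" "w' \<in> carrier G" using x y subgroup.subset[OF W] by auto
    \<comment> \<open>Left multiplication by this element turns \<open>w\<close> into
      \<open>w'\<close>, so its word describes a path between the two given faces.\<close>
    have "w' \<otimes> inv w \<in> ?W"
      using W x(3) y(3) by (metis subgroup.m_closed subgroup.m_inv_closed)
    then have "(face k (w \<otimes> \<phi>), face l (w' \<otimes> inv w \<otimes> w \<otimes> \<phi>)) \<in> (Restr (incid \<union> incid\<inverse>) ?P)\<^sup>*"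
      using x y by (intro sect_connected_generated rk) auto
    moreover have "w' \<otimes> inv w \<otimes> w = w'" using c by (simp add: m_assoc)
    moreover have "?P \<subseteq> sect" by (auto simp: proper_faces_def)
    then have "Restr (Restr incid sect \<union> (Restr incid sect)\<inverse>) ?P = Restr (incid \<union> incid\<inverse>) ?P"
      by blast
    ultimately show ?thesis using x y by simp
  qed
  \<comment> \<open>The section has rank \<open>j - i - 1\<close>, so rank at most 1 is exactly the
    negation of \<open>i + 2 < j\<close>.\<close>
  then have "j - i - 1 \<le> 1 \<or>
      (\<forall>x\<in>?P. \<forall>y\<in>?P. (x, y) \<in> (Restr (Restr incid sect \<union> (Restr incid sect)\<inverse>) ?P)\<^sup>*)"
    by (cases "i + 2 < j") auto
  then show ?thesis unfolding connected_poset_def using sect_rank by blast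
qed

end

section \<open>The whole poset: improper faces, ranks, flags and intermediate faces\<close>

lemma least_face:
  assumes "\<phi> \<in> carrier G" shows "is_least faces incid (face (-1) \<phi>)"
  unfolding is_least_def
proof
  show "face (-1) \<phi> \<in> faces" using assms by (intro face_in_faces) auto
  show "\<forall>y\<in>faces. (face (-1) \<phi>, y) \<in> incid"
  proof
    fix y assume "y \<in> faces"
    then obtain j \<psi> where y: "y = face j \<psi>" "j \<in> \<N>" "\<psi> \<in> carrier G" by (rule facesE)
    then have "(face (-1) \<psi>, y) \<in> incid" using incid_face[of \<psi> "-1" j] by auto
    then show "(face (-1) \<phi>, y) \<in> incid"
      using face_improper[of "-1" \<phi> \<psi>] assms y by simp
  qed
qed

lemma greatest_face:
  assumes "\<phi> \<in> carrier G" shows "is_greatest faces incid (face (int n) \<phi>)"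
  unfolding is_greatest_def
proof
  show "face (int n) \<phi> \<in> faces" using assms by (intro face_in_faces) auto
  show "\<forall>y\<in>faces. (y, face (int n) \<phi>) \<in> incid"
  proof
    fix y assume "y \<in> faces"
    then obtain j \<psi> where y: "y = face j \<psi>" "j \<in> \<N>" "\<psi> \<in> carrier G" by (rule facesE)
    then have "(y, face (int n) \<psi>) \<in> incid" using incid_face[of \<psi> j "int n"] by auto
    then show "(y, face (int n) \<phi>) \<in> incid"
      using face_improper[of "int n" \<phi> \<psi>] assms y by simp
  qed
qed

text \<open>The tag agrees with the order-theoretic rank because the section from rank
  \<open>-1\<close> up to rank \<open>j\<close> has rank \<open>j - (-1) - 1\<close>.\<close>

lemma face_rank:
  assumes "F \<in> faces" shows "face_has_rank faces incid F k \<longleftrightarrow> k = fst F"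
proof -
  obtain j \<phi> where F: "F = face j \<phi>" "j \<in> \<N>" "\<phi> \<in> carrier G" using assms by (rule facesE)
  have least: "is_least faces incid E \<longleftrightarrow> E = face (-1) \<phi>" for E
    using least_face[OF F(3)] incid_antisym unfolding is_least_def by blast
  have "has_rank (Restr incid (section_of faces incid (face (-1) \<phi>) (face j \<phi>))) k \<longleftrightarrow> k = j - (-1) - 1"
    using F by (intro sect_rank) auto
  then show ?thesis unfolding face_has_rank_def least F(1) by simp
qed

text \<open>The whole poset is the section between its improper faces. Passing through these is no
  restriction, as they do not depend on the representative.\<close>

lemma flags_incid: "flags incid = {flag \<psi> \<N> | \<psi>. \<psi> \<in> carrier G}"
proof -
  let ?Q = "section_of faces incid (face (-1) \<one>) (face (int n) \<one>)"
  have "?Q = faces"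
    using least_face[OF one_closed] greatest_face[OF one_closed]
    by (auto simp: section_of_def is_least_def is_greatest_def)
  moreover have "incid \<subseteq> faces \<times> faces" by (auto elim!: incidE intro!: face_in_faces)
  ultimately have "Restr incid ?Q = incid" by blast
  moreover have "flags (Restr incid ?Q) = {flag \<psi> \<N> | \<psi>. \<psi> \<in> carrier G \<and>
      face (-1) \<psi> = face (-1) \<one> \<and> face (int n) \<psi> = face (int n) \<one>}"
    by (rule flags_sect) auto
  moreover have "\<psi> \<in> carrier G \<and> face (-1) \<psi> = face (-1) \<one> \<and> face (int n) \<psi> = face (int n) \<one>
      \<longleftrightarrow> \<psi> \<in> carrier G" for \<psi>
    using face_improper[of "-1" \<psi> \<one>] face_improper[of "int n" \<psi> \<one>] by blast
  ultimately show ?thesis by simp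
qed

lemma chain_in_flag:
  assumes "C \<in> Chains incid"
  shows "\<exists>D\<in>flags incid. C \<subseteq> D \<and> finite D \<and> card D = n + 2"
proof -
  obtain \<psi> where \<psi>: "\<psi> \<in> carrier G" "C \<subseteq> flag \<psi> \<N>"
    using finite_chain_subset_flag chain_finite assms by blast
  have "card (flag \<psi> \<N>) = n + 2" by (simp add: card_flag)
  then show ?thesis unfolding flags_incid using \<psi> by blast
qed

lemma two_faces_between:
  assumes i: "i \<in> {0..int n - 1}" and FH: "(F, H) \<in> incid" "fst F = i - 1" "fst H = i + 1"
  shows "\<exists>E1 E2. E1 \<noteq> E2 \<and> (\<forall>E\<in>{E1, E2}. E \<in> faces \<and> face_has_rank faces incid E i \<and>
              (F, E) \<in> incid \<and> F \<noteq> E \<and> (E, H) \<in> incid \<and> E \<noteq> H)"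
proof -
  obtain a b \<phi> where ab: "F = face a \<phi>" "H = face b \<phi>" "\<phi> \<in> carrier G" using FH(1) by (rule incidE)
  have F: "F = face (i - 1) \<phi>" and H: "H = face (i + 1) \<phi>" using ab FH by auto
  have iN: "i \<in> \<N>" "i - 1 \<in> \<N>" "i + 1 \<in> \<N>" using i by auto
  obtain r where r: "r \<in> R i" "r \<notin> R (-1)" using R_proper[OF i] by blast
  have rc: "r \<in> carrier G" using r R_subset_carrier[OF iN(1)] by blast
  \<comment> \<open>The index sets are disjoint, and \<open>Gam\<close> of the empty set is
    \<open>R (-1)\<close>.\<close>
  have "Gam G R {i} \<inter> Gam_del G n R i = Gam G R ({i} \<inter> (\<N> - {i}))"
    unfolding Gam_del_def by (rule intersection_property) (use iN in auto)
  then have "R i \<inter> Gam_del G n R i = R (-1)"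
    using Gam_singleton[OF iN(1)] by (simp add: Gam_def)
  then have "r \<notin> Gam_del G n R i" using r by blast
  moreover have "r \<otimes> \<phi> \<otimes> inv \<phi> = r" using rc ab(3) by (simp add: m_assoc)
  ultimately have ne: "face i (r \<otimes> \<phi>) \<noteq> face i \<phi>" using rc ab(3) by (simp add: face_eq_iff)
  \<comment> \<open>Being a generator of index \<open>i\<close>, \<open>r\<close> keeps the
    neighbours of ranks \<open>i - 1\<close> and \<open>i + 1\<close>, so the new
    \<open>i\<close>-face lies between the same \<open>F\<close> and \<open>H\<close>.\<close>
  have "r \<in> Gam_del G n R (i - 1)" "r \<in> Gam_del G n R (i + 1)"
    unfolding Gam_del_def
    using r R_subset_Gam[of i "\<N> - {i - 1}"] R_subset_Gam[of i "\<N> - {i + 1}"] iN by auto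
  then have F': "F = face (i - 1) (r \<otimes> \<phi>)" and H': "H = face (i + 1) (r \<otimes> \<phi>)"
    unfolding F H using ab(3) by (simp_all add: face_mult)
  have good: "face i \<psi> \<in> faces \<and> face_has_rank faces incid (face i \<psi>) i \<and>
      (F, face i \<psi>) \<in> incid \<and> F \<noteq> face i \<psi> \<and> (face i \<psi>, H) \<in> incid \<and> face i \<psi> \<noteq> H"
    if \<psi>: "\<psi> \<in> carrier G" "F = face (i - 1) \<psi>" "H = face (i + 1) \<psi>" for \<psi>
  proof -
    have f: "face i \<psi> \<in> faces" using iN \<psi> by (intro face_in_faces)
    moreover have "face_has_rank faces incid (face i \<psi>) i" using face_rank[OF f] by simp
    moreover have "(F, face i \<psi>) \<in> incid" "(face i \<psi>, H) \<in> incid"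
      unfolding \<psi>(2,3) using iN \<psi>(1) by (auto intro!: incid_face)
    moreover have "F \<noteq> face i \<psi>" "face i \<psi> \<noteq> H"
      using FH(2,3) by auto
    ultimately show ?thesis by blast
  qed
  show ?thesis
    using ne good[OF _ F' H'] good[OF ab(3) F H] rc ab(3) by blast
qed

lemma incidence_complex_incid: "incidence_complex n faces incid"
  unfolding incidence_complex_def
proof (intro conjI ballI impI)
  show "partial_order_on faces incid" by (rule partial_order_incid)
  show "\<exists>F. is_least faces incid F" "\<exists>F. is_greatest faces incid F"
    using least_face greatest_face by blast+
  show "\<exists>D\<in>flags incid. C \<subseteq> D \<and> finite D \<and> card D = n + 2" if "C \<in> Chains incid" for C
    using that by (rule chain_in_flag)
next
  fix F H assume "(F, H) \<in> incid"
  then obtain i j \<phi> where "F = face i \<phi>" "H = face j \<phi>" "i \<in> \<N>" "j \<in> \<N>" "i \<le> j" "\<phi> \<in> carrier G"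
    by (rule incidE)
  then show "connected_poset (section_of faces incid F H) (Restr incid (section_of faces incid F H))"
    using sect_connected by simp
next
  fix i F H
  assume "i \<in> {0..int n - 1}" "F \<in> faces" "H \<in> faces"
    and "(F, H) \<in> incid \<and> F \<noteq> H \<and> face_has_rank faces incid F (i - 1) \<and> face_has_rank faces incid H (i + 1)"
  then show "\<exists>E1 E2. E1 \<noteq> E2 \<and> (\<forall>E\<in>{E1, E2}. E \<in> faces \<and> face_has_rank faces incid E i \<and>
              (F, E) \<in> incid \<and> F \<noteq> E \<and> (E, H) \<in> incid \<and> E \<noteq> H)"
    by (intro two_faces_between) (simp_all add: face_rank)
qed

section \<open>The action on faces\<close>

lemma act_face:
  "\<gamma> \<in> carrier G \<Longrightarrow> \<phi> \<in> carrier G \<Longrightarrow> K_act G \<gamma> (face i \<phi>) = face i (\<phi> \<otimes> \<gamma>)"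
  unfolding K_act_def K_face_def
  by (simp add: coset_mult_assoc subgroup.subset[OF Gam_del_subgroup])

lemma act_one: "F \<in> faces \<Longrightarrow> K_act G \<one> F = F"
  by (auto elim!: facesE simp: act_face)

lemma act_mult:
  "\<gamma> \<in> carrier G \<Longrightarrow> \<delta> \<in> carrier G \<Longrightarrow> F \<in> faces \<Longrightarrow> K_act G (\<gamma> \<otimes> \<delta>) F = K_act G \<delta> (K_act G \<gamma> F)"
  by (auto elim!: facesE simp: act_face m_assoc)

lemma act_in_faces: "\<gamma> \<in> carrier G \<Longrightarrow> F \<in> faces \<Longrightarrow> K_act G \<gamma> F \<in> faces"
  by (auto elim!: facesE simp: act_face intro!: face_in_faces)

text \<open>A common representative of two faces, multiplied by \<open>\<gamma>\<close>, is a common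
  representative of their images.\<close>

lemma act_incid:
  assumes "\<gamma> \<in> carrier G" "(F, H) \<in> incid" shows "(K_act G \<gamma> F, K_act G \<gamma> H) \<in> incid"
proof -
  obtain i j \<phi> where "F = face i \<phi>" "H = face j \<phi>" "i \<in> \<N>" "j \<in> \<N>" "i \<le> j" "\<phi> \<in> carrier G"
    using assms(2) by (rule incidE)
  then show ?thesis using assms(1) incid_face[of "\<phi> \<otimes> \<gamma>" i j] by (simp add: act_face)
qed

lemma act_automorphism:
  assumes \<gamma>: "\<gamma> \<in> carrier G" shows "poset_automorphism faces incid (K_act G \<gamma>)"
proof -
  have inv: "K_act G (inv \<gamma>) (K_act G \<gamma> F) = F" "K_act G \<gamma> (K_act G (inv \<gamma>) F) = F" if "F \<in> faces" for F
    using \<gamma> that by (simp_all flip: act_mult add: act_one)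
  have "bij_betw (K_act G \<gamma>) faces faces"
    using \<gamma> inv by (intro bij_betw_byWitness[where f' = "K_act G (inv \<gamma>)"]) (auto intro!: act_in_faces)
  moreover have "(F, H) \<in> incid \<longleftrightarrow> (K_act G \<gamma> F, K_act G \<gamma> H) \<in> incid" if "F \<in> faces" "H \<in> faces" for F H
    using act_incid[OF \<gamma>, of F H] act_incid[OF inv_closed[OF \<gamma>], of "K_act G \<gamma> F" "K_act G \<gamma> H"]
      inv that by auto
  ultimately show ?thesis unfolding poset_automorphism_def by blast
qed

lemma act_flag_transitive:
  assumes "C \<in> flags incid" "D \<in> flags incid" shows "\<exists>\<gamma>\<in>carrier G. K_act G \<gamma> ` C = D"
proof -
  obtain \<phi> \<psi> where C: "C = flag \<phi> \<N>" "\<phi> \<in> carrier G" and D: "D = flag \<psi> \<N>" "\<psi> \<in> carrier G"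
    using assms unfolding flags_incid by blast
  \<comment> \<open>Faces are right cosets, so this one right factor replaces \<open>\<phi>\<close>
    by \<open>\<psi>\<close> in all ranks at once.\<close>
  let ?\<gamma> = "inv \<phi> \<otimes> \<psi>"
  have "\<phi> \<otimes> ?\<gamma> = \<psi>" using C D by (simp flip: m_assoc)
  then have "K_act G ?\<gamma> (face k \<phi>) = face k \<psi>" for k using C D by (simp add: act_face)
  then have "K_act G ?\<gamma> ` C = D" unfolding C(1) D(1) image_image by simp
  then show ?thesis using C D by blast
qed

lemma finite_faces:
  assumes "finite (carrier G)" shows "finite faces"
proof -
  have "faces \<subseteq> (\<lambda>(i, \<phi>). face i \<phi>) ` (\<N> \<times> carrier G)" unfolding K_faces_def by force
  then show ?thesis using assms by (auto intro: finite_subset)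
qed

end

theorem theorem4p1:
  fixes G :: "('a, 'b) monoid_scheme" and n :: nat and R :: "int \<Rightarrow> 'a set"
  assumes "n \<ge> 1"
    and "generalized_string_C_group G n R"
  shows "regular_incidence_complex n (K_faces G n R) (K_order G n R)
    \<and> (\<forall>\<gamma> \<in> carrier G. \<forall>i \<in> {-1..int n}. \<forall>\<phi> \<in> carrier G.
         K_act G \<gamma> (K_face G n R i \<phi>) = K_face G n R i (\<phi> \<otimes>\<^bsub>G\<^esub> \<gamma>))
    \<and> (\<forall>F \<in> K_faces G n R. K_act G \<one>\<^bsub>G\<^esub> F = F)
    \<and> (\<forall>\<gamma> \<in> carrier G. \<forall>\<delta> \<in> carrier G. \<forall>F \<in> K_faces G n R.
         K_act G (\<gamma> \<otimes>\<^bsub>G\<^esub> \<delta>) F = K_act G \<delta> (K_act G \<gamma> F))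
    \<and> (\<forall>\<gamma> \<in> carrier G. poset_automorphism (K_faces G n R) (K_order G n R) (K_act G \<gamma>))
    \<and> (\<forall>C \<in> flags (K_order G n R). \<forall>D \<in> flags (K_order G n R).
         \<exists>\<gamma> \<in> carrier G. K_act G \<gamma> ` C = D)
    \<and> (finite (carrier G) \<longrightarrow> finite (K_faces G n R))"
proof -
  interpret generalized_string_C_group G n R by (rule assms(2))
  have "regular_incidence_complex n (K_faces G n R) (K_order G n R)"
    unfolding regular_incidence_complex_def
    using incidence_complex_incid act_flag_transitive act_automorphism by blast
  then show ?thesis
    using act_face act_one act_mult act_automorphism act_flag_transitive finite_faces by simp
qed

end
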